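(* Let $k$ be an odd positive integer. Then $$\sum_{n=1}^{k-1}\frac{\sin^2(\pi n/k)}{\sin^4(2\pi n/k)}=\frac{1}{48}\left(k^4+6k^2-7\right).$$ *)

theory Defs
  imports Complex_Main
begin

end

theory Submission
  imports Defs
begin

text \<open>
  With x = \<pi>n/k and w = exp(2ix), a k-th root of unity, the summand is
  1/16 (1/sin^2 x + 1/cos^2 x + 1/cos^4 x), where 4 sin^2 x = |1 - w|^2 and 4 cos^2 x = |1 + w|^2.
  Since w^k = 1 and k is odd, 1/(1 - w), 2/(1 + w) and 4/(1 + w)^2 are polynomials in w of degree
  less than k, namely -1/k \<Sum> m w^m, \<Sum> (-w)^m and \<Sum> (2m + 2 - k) (-w)^m (the first one for w \<noteq> 1).
  Parseval's identity then reduces each of the three sums to a sum of squared coefficients.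
\<close>

section \<open>Parseval's identity on the k-th roots of unity\<close>

lemma cis_eq_1_imp_int:
  assumes "cis (2 * pi * t) = 1"
  shows "t \<in> \<int>"
proof -
  have "cos (2 * pi * t) = 1"
    using assms by (metis cis.sel(1) one_complex.sel(1))
  then obtain j :: int where "2 * pi * t = of_int j * 2 * pi"
    by (auto simp: cos_one_2pi_int)
  then have "t = of_int j"
    by simp
  then show ?thesis
    by simp
qed

text \<open>Each summand is \<open>z ^ n\<close> for the single root of unity
  \<open>z = cis (2 * pi * t)\<close>, \<open>t = (p - q) / k\<close>, so the sum is geometric with
  \<open>z ^ k = 1\<close>. For distinct \<open>p\<close> and \<open>q\<close> below
  \<open>k\<close>, \<open>t\<close> is nonzero with absolute value below 1, hence not an integer;
  so \<open>z\<close> differs from 1 and the sum vanishes.\<close>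

lemma roots_of_unity_orthogonal:
  fixes k p q :: nat
  assumes "p < k" "q < k"
  shows "(\<Sum>n<k. cis (2 * pi * real n / real k) ^ p * cnj (cis (2 * pi * real n / real k) ^ q))
    = (if p = q then of_nat k else 0)"
proof -
  define t where "t = (real p - real q) / real k"
  define z where "z = cis (2 * pi * t)"
  have k: "real k > 0"
    using assms by simp
  have term_eq: "cis (2 * pi * real n / real k) ^ p * cnj (cis (2 * pi * real n / real k) ^ q) = z ^ n"
    for n
    using k by (simp add: z_def t_def Complex.DeMoivre cis_cnj cis_mult field_simps)
  show ?thesis
  proof (cases "p = q")
    case True
    then show ?thesis
      unfolding term_eq by (simp add: z_def t_def)
  next
    case False
    have "real k * (2 * pi * t) = 2 * pi * of_int (int p - int q)"
      using k by (simp add: t_def)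
    then have zk: "z ^ k = 1"
      using cis_multiple_2pi[of "of_int (int p - int q)"] by (simp only: z_def Complex.DeMoivre) simp
    have "t \<noteq> 0" "\<bar>t\<bar> < 1"
      using False assms k by (auto simp: t_def abs_less_iff field_simps)
    then have "t \<notin> \<int>"
      using Ints_nonzero_abs_less1 by blast
    then have "z \<noteq> 1"
      using cis_eq_1_imp_int[of t] by (auto simp: z_def)
    then show ?thesis
      unfolding term_eq using False by (simp add: sum_gp_strict zk)
  qed
qed

text \<open>Writing the squared modulus as G times its conjugate gives a double sum over
  \<open>p\<close> and \<open>q\<close>; moving the sum over \<open>n\<close> innermost lets
  orthogonality leave only the diagonal. The coefficients are real, so conjugation affects only the
  powers of the root.\<close>

lemma parseval_roots_of_unity:
  fixes a :: "nat \<Rightarrow> real" and k :: nat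
  shows "(\<Sum>n<k. (cmod (\<Sum>m<k. of_real (a m) * cis (2 * pi * real n / real k) ^ m))\<^sup>2)
    = real k * (\<Sum>m<k. (a m)\<^sup>2)"
proof -
  define w where "w n = cis (2 * pi * real n / real k)" for n :: nat
  have "complex_of_real (\<Sum>n<k. (cmod (\<Sum>m<k. of_real (a m) * w n ^ m))\<^sup>2)
      = (\<Sum>n<k. \<Sum>p<k. \<Sum>q<k. of_real (a p * a q) * (w n ^ p * cnj (w n ^ q)))"
    by (simp only: of_real_sum complex_norm_square cnj_sum sum_product) (simp add: mult_ac)
  also have "\<dots> = (\<Sum>p<k. \<Sum>n<k. \<Sum>q<k. of_real (a p * a q) * (w n ^ p * cnj (w n ^ q)))"
    by (rule sum.swap)
  also have "\<dots> = (\<Sum>p<k. \<Sum>q<k. \<Sum>n<k. of_real (a p * a q) * (w n ^ p * cnj (w n ^ q)))"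
    by (intro sum.cong refl sum.swap)
  also have "\<dots> = (\<Sum>p<k. \<Sum>q<k. of_real (a p * a q) * (if p = q then of_nat k else 0))"
    by (intro sum.cong refl)
      (simp only: sum_distrib_left[symmetric] w_def roots_of_unity_orthogonal lessThan_iff)
  also have "\<dots> = (\<Sum>p<k. of_real (a p * a p) * of_nat k)"
    by (intro sum.cong refl) (simp add: if_distrib sum.delta cong: if_cong)
  also have "\<dots> = of_real (real k * (\<Sum>m<k. (a m)\<^sup>2))"
    by (simp add: sum_distrib_left power2_eq_square mult_ac)
  finally show ?thesis
    by (simp only: of_real_eq_iff w_def)
qed

text \<open>Multiplying by \<open>(1 - z)\<close> twice takes second differences of the linear
  coefficients, leaving only boundary terms. Keeping the factor on the left avoids division, so
  \<open>z = 1\<close> is covered. It serves for the coefficients of both 1/(1 - w) and 4/(1 +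
  w)^2.\<close>

lemma sum_linear_gp:
  fixes z c d :: "'a::comm_ring_1"
  shows "(1 - z)\<^sup>2 * (\<Sum>m<N. (d * of_nat m + c) * z ^ m)
    = c + (d - c) * z - z ^ N * (d * of_nat N + c) + z ^ Suc N * (d * of_nat N + c - d)"
proof (induction N)
  case (Suc N)
  then show ?case
    by (simp add: distrib_left) (simp add: algebra_simps power2_eq_square)
qed (simp add: algebra_simps)

section \<open>Moduli of 1 + w and 1 - w, and power sums\<close>

lemma cis_root_of_unity_power:
  fixes k n :: nat
  assumes "k > 0"
  shows "cis (2 * pi * real n / real k) ^ k = 1"
proof -
  have "real k * (2 * pi * real n / real k) = 2 * pi * of_int (int n)"
    using assms by simp
  then show ?thesis
    using cis_multiple_2pi[of "of_int (int n)"] by (simp add: Complex.DeMoivre)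
qed

lemma cmod_one_plus_cis: "(cmod (1 + cis (2 * x)))\<^sup>2 = 4 * (cos x)\<^sup>2"
proof -
  have "(cmod (1 + cis (2 * x)))\<^sup>2 = 2 + 2 * cos (2 * x)"
    using sin_cos_squared_add[of "2 * x"]
    by (simp add: cmod_power2 power2_sum)
  then show ?thesis
    by (simp add: cos_double_cos)
qed

lemma cmod_one_minus_cis: "(cmod (1 - cis (2 * x)))\<^sup>2 = 4 * (sin x)\<^sup>2"
proof -
  have "(cmod (1 - cis (2 * x)))\<^sup>2 = 2 - 2 * cos (2 * x)"
    using sin_cos_squared_add[of "2 * x"]
    by (simp add: cmod_power2 power2_diff)
  then show ?thesis
    by (simp add: cos_double_sin)
qed

lemma sum_squares_below: "(\<Sum>m<k. (real m)\<^sup>2) = real k * (real k - 1) * (2 * real k - 1) / 6"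
  by (induction k) (auto simp: field_simps power2_eq_square)

lemma sum_below: "(\<Sum>m<k. real m) = real k * (real k - 1) / 2"
  by (induction k) (auto simp: field_simps)

lemma sum_atLeast1_eq_sum_lessThan:
  fixes f :: "nat \<Rightarrow> real"
  assumes "k > 0"
  shows "(\<Sum>n=1..k-1. f n) = (\<Sum>n<k. f n) - f 0"
proof -
  have "{..<k} = insert 0 {1..k-1}"
    using assms by auto
  then show ?thesis
    by simp
qed

section \<open>The three reciprocal power sums\<close>

lemma sum_inverse_cos_power2:
  fixes k :: nat
  assumes "odd k"
  shows "(\<Sum>n<k. 1 / cos (pi * real n / real k) ^ 2) = (real k)\<^sup>2"
proof -
  define a where "a m = (-1::real) ^ m" for m :: nat
  have "1 / cos (pi * real n / real k) ^ 2
      = (cmod (\<Sum>m<k. of_real (a m) * cis (2 * pi * real n / real k) ^ m))\<^sup>2" for n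
  proof -
    define x where "x = pi * real n / real k"
    define w where "w = cis (2 * x)"
    define G where "G = (\<Sum>m<k. of_real (a m) * w ^ m)"
    have w: "w = cis (2 * pi * real n / real k)"
      by (simp add: w_def x_def mult.assoc)
    \<comment> \<open>Oddness of \<open>k\<close> enters here: it makes 1 - (-w)^k equal to 2
      instead of 0.\<close>
    have wk: "(- w) ^ k = -1"
      using cis_root_of_unity_power[of k n] assms by (simp add: w odd_pos)
    have "G = (\<Sum>m<k. (- w) ^ m)"
      unfolding G_def a_def by (intro sum.cong refl) (simp add: power_minus[of w])
    then have "(1 + w) * G = 2"
      using one_diff_power_eq[of "- w" k] wk by simp
    then have "(cmod (1 + w))\<^sup>2 * (cmod G)\<^sup>2 = 4"
      by (metis norm_mult norm_numeral power_mult_distrib num_double power2_eq_square numeral_times_numeral)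
    then have "(cos x)\<^sup>2 * (cmod G)\<^sup>2 = 1"
      by (simp add: w_def cmod_one_plus_cis)
    \<comment> \<open>A product equal to 1 has nonzero factors, so dividing by the squared cosine is
      justified.\<close>
    then have "(cmod G)\<^sup>2 = 1 / (cos x)\<^sup>2"
      by (metis mult_eq_0_iff nonzero_mult_div_cancel_left one_neq_zero)
    then show ?thesis
      by (simp add: G_def w x_def)
  qed
  then have "(\<Sum>n<k. 1 / cos (pi * real n / real k) ^ 2) = real k * (\<Sum>m<k. (a m)\<^sup>2)"
    by (simp only: parseval_roots_of_unity)
  also have "\<dots> = (real k)\<^sup>2"
    by (simp add: a_def power2_eq_square flip: power_mult_distrib)
  finally show ?thesis .
qed

lemma sum_inverse_cos_power4:
  fixes k :: nat
  assumes "odd k"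
  shows "(\<Sum>n<k. 1 / cos (pi * real n / real k) ^ 4) = (real k ^ 4 + 2 * (real k)\<^sup>2) / 3"
proof -
  \<comment> \<open>Put \<open>z = - w\<close>, \<open>d = 2\<close>, \<open>N = k\<close> in
    \<open>sum_linear_gp\<close>. As \<open>z ^ k = -1\<close>, the right side becomes (2c + 2k) + z
    (4 - 2c - 2k). The choice \<open>c = 2 - k\<close> kills the coefficient of \<open>z\<close> and
    leaves the constant 4.\<close>
  define a where "a m = (-1) ^ m * (2 * real m + (2 - real k))" for m :: nat
  have "1 / cos (pi * real n / real k) ^ 4
      = (cmod (\<Sum>m<k. of_real (a m) * cis (2 * pi * real n / real k) ^ m))\<^sup>2" for n
  proof -
    define x where "x = pi * real n / real k"
    define w where "w = cis (2 * x)"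
    define G where "G = (\<Sum>m<k. of_real (a m) * w ^ m)"
    have w: "w = cis (2 * pi * real n / real k)"
      by (simp add: w_def x_def mult.assoc)
    have wk: "(- w) ^ k = -1"
      using cis_root_of_unity_power[of k n] assms by (simp add: w odd_pos)
    have "G = (\<Sum>m<k. (2 * of_nat m + (2 - of_nat k)) * (- w) ^ m)"
      unfolding G_def a_def by (intro sum.cong refl) (simp add: power_minus[of w])
    then have "(1 + w)\<^sup>2 * G = 4"
      using sum_linear_gp[of "- w" 2 "2 - of_nat k" k]
      by (simp only: power_Suc wk) (simp add: algebra_simps)
    then have "((cmod (1 + w))\<^sup>2)\<^sup>2 * (cmod G)\<^sup>2 = 4\<^sup>2"
      by (metis norm_mult norm_numeral norm_power power_mult_distrib)
    then have "cos x ^ 4 * (cmod G)\<^sup>2 = 1"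
      by (simp add: w_def cmod_one_plus_cis power_mult_distrib flip: power_mult)
    then have "(cmod G)\<^sup>2 = 1 / cos x ^ 4"
      by (metis mult_eq_0_iff nonzero_mult_div_cancel_left one_neq_zero)
    then show ?thesis
      by (simp add: G_def w x_def)
  qed
  then have "(\<Sum>n<k. 1 / cos (pi * real n / real k) ^ 4) = real k * (\<Sum>m<k. (a m)\<^sup>2)"
    by (simp only: parseval_roots_of_unity)
  also have "(\<Sum>m<k. (a m)\<^sup>2)
      = (\<Sum>m<k. 4 * (real m)\<^sup>2 + (4 * (2 - real k) * real m + (2 - real k)\<^sup>2))"
  proof (intro sum.cong refl)
    fix m
    have "((-1::real) ^ m)\<^sup>2 = 1"
      by (simp flip: power_mult)
    then show "(a m)\<^sup>2 = 4 * (real m)\<^sup>2 + (4 * (2 - real k) * real m + (2 - real k)\<^sup>2)"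
      by (simp only: a_def power_mult_distrib) (simp add: power2_eq_square algebra_simps)
  qed
  also have "\<dots> = 4 * (real k * (real k - 1) * (2 * real k - 1) / 6)
      + (4 * (2 - real k) * (real k * (real k - 1) / 2) + real k * (2 - real k)\<^sup>2)"
    by (simp only: sum.distrib sum_distrib_left[symmetric] sum_squares_below sum_below) simp
  finally show ?thesis
    by (simp add: field_simps power2_eq_square power4_eq_xxxx)
qed

text \<open>The coefficients \<open>m\<close> represent -k/(1 - w) only for w different from 1.
  Parseval includes n = 0, where w = 1, so the value \<open>f 0\<close>, the square of k(k - 1)/2,
  has to be subtracted.\<close>

lemma sum_inverse_sin_power2:
  fixes k :: nat
  assumes "k > 0"
  shows "(\<Sum>n=1..k-1. 1 / sin (pi * real n / real k) ^ 2) = ((real k)\<^sup>2 - 1) / 3"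
proof -
  define f where "f n = (cmod (\<Sum>m<k. of_real (real m) * cis (2 * pi * real n / real k) ^ m))\<^sup>2"
    for n :: nat
  have f: "1 / sin (pi * real n / real k) ^ 2 = 4 / (real k)\<^sup>2 * f n" if n: "n \<in> {1..k-1}" for n
  proof -
    define x where "x = pi * real n / real k"
    define w where "w = cis (2 * x)"
    define G where "G = (\<Sum>m<k. of_nat m * w ^ m)"
    have w: "w = cis (2 * pi * real n / real k)"
      by (simp add: w_def x_def mult.assoc)
    have "0 < x" "x < pi"
      using n by (auto simp: x_def field_simps)
    then have s: "sin x \<noteq> 0"
      using sin_gt_zero by force
    then have w1: "1 - w \<noteq> 0"
      using cmod_one_minus_cis[of x] by (auto simp: w_def)
    \<comment> \<open>With \<open>d = 1\<close>, \<open>c = 0\<close> and \<open>w ^ k = 1\<close>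
      the closed form is w - k + (k - 1) w = -k (1 - w), so one factor \<open>1 - w\<close> can be
      cancelled.\<close>
    have "(1 - w)\<^sup>2 * G = - (of_nat k * (1 - w))"
      using sum_linear_gp[of w 1 0 k] cis_root_of_unity_power[OF assms, of n, folded w]
      by (simp add: G_def algebra_simps)
    then have "(1 - w) * ((1 - w) * G) = (1 - w) * - of_nat k"
      by (simp add: power2_eq_square mult_ac)
    then have "(1 - w) * G = - of_nat k"
      using mult_left_cancel[OF w1] by blast
    then have "(cmod (1 - w))\<^sup>2 * (cmod G)\<^sup>2 = (real k)\<^sup>2"
      by (metis norm_minus_cancel norm_mult norm_of_nat power_mult_distrib)
    then have "4 * (sin x)\<^sup>2 * f n = (real k)\<^sup>2"
      by (simp add: f_def G_def w[symmetric]) (simp add: w_def cmod_one_minus_cis)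
    then have "1 / (sin x)\<^sup>2 = 4 / (real k)\<^sup>2 * f n"
      using s assms by (simp add: field_simps)
    then show ?thesis
      by (simp add: x_def)
  qed
  have "f 0 = (\<Sum>m<k. real m)\<^sup>2"
  proof -
    have "f 0 = (cmod (of_real (\<Sum>m<k. real m)))\<^sup>2"
      by (simp add: f_def)
    then show ?thesis
      by (simp only: norm_of_real power2_abs)
  qed
  then have "(\<Sum>n=1..k-1. f n)
      = real k * (real k * (real k - 1) * (2 * real k - 1) / 6) - (real k * (real k - 1) / 2)\<^sup>2"
    using parseval_roots_of_unity[of real k] sum_atLeast1_eq_sum_lessThan[OF assms, of f]
    by (simp only: f_def[symmetric] sum_squares_below sum_below)
  moreover have "(\<Sum>n=1..k-1. 1 / sin (pi * real n / real k) ^ 2)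
      = 4 / (real k)\<^sup>2 * (\<Sum>n=1..k-1. f n)"
    unfolding sum_distrib_left by (intro sum.cong refl f)
  moreover have "4 / (real k)\<^sup>2
      * (real k * (real k * (real k - 1) * (2 * real k - 1) / 6) - (real k * (real k - 1) / 2)\<^sup>2)
      = ((real k)\<^sup>2 - 1) / 3"
    using assms by (simp add: field_simps power2_eq_square)
  ultimately show ?thesis
    by simp
qed

section \<open>Partial fractions and assembly\<close>

lemma sin_squared_div_sin_double_power4:
  fixes x :: real
  assumes "sin x \<noteq> 0" "cos x \<noteq> 0"
  shows "sin x ^ 2 / sin (2 * x) ^ 4 = (1 / sin x ^ 2 + 1 / cos x ^ 2 + 1 / cos x ^ 4) / 16"
proof -
  define s c where "s = (sin x)\<^sup>2" and "c = (cos x)\<^sup>2"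
  have sc: "s \<noteq> 0" "c \<noteq> 0" "s = 1 - c"
    using assms by (simp_all add: s_def c_def) (simp add: sin_squared_eq)
  have "sin x ^ 2 / sin (2 * x) ^ 4 = s / (16 * s\<^sup>2 * c\<^sup>2)"
    by (simp add: s_def c_def sin_double power_mult_distrib flip: power_mult)
  also have "\<dots> = (1 / s + 1 / c + 1 / c\<^sup>2) / 16"
  proof -
    have "1 / s + 1 / c + 1 / c\<^sup>2 = (c\<^sup>2 + s * c + s) / (s * c\<^sup>2)"
      using sc(1,2) by (simp add: field_simps power2_eq_square)
    \<comment> \<open>Since \<open>s + c = 1\<close>, the numerator is c (c + s) + s = c + s =
      1.\<close>
    also have "c\<^sup>2 + s * c + s = 1"
      by (simp add: sc(3) power2_eq_square algebra_simps)
    finally show ?thesis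
      using sc(1,2) by (simp add: power2_eq_square)
  qed
  finally show ?thesis
    by (simp add: s_def c_def flip: power_mult)
qed

theorem mainTheorem3:
  fixes k :: nat
  assumes "odd k" and "k > 0"
  shows "(\<Sum>n=1..k-1. sin (pi * real n / real k) ^ 2 / sin (2 * pi * real n / real k) ^ 4)
           = (real k ^ 4 + 6 * real k ^ 2 - 7) / 48"
proof -
  have "sin (pi * real n / real k) ^ 2 / sin (2 * pi * real n / real k) ^ 4
      = (1 / sin (pi * real n / real k) ^ 2 + 1 / cos (pi * real n / real k) ^ 2
        + 1 / cos (pi * real n / real k) ^ 4) / 16" if n: "n \<in> {1..k-1}" for n
  proof -
    define x where "x = pi * real n / real k"
    have "0 < x" "x < pi"
      using n by (auto simp: x_def field_simps)
    then have s: "sin x \<noteq> 0"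
      using sin_gt_zero by force
    \<comment> \<open>A zero of the cosine in (0, pi) would be pi/2, giving 2n = k against the
      oddness of \<open>k\<close>.\<close>
    have "cos x \<noteq> 0"
    proof
      assume "cos x = 0"
      with \<open>0 < x\<close> \<open>x < pi\<close> have "x = pi / 2"
        using cos_inj_pi[of x "pi / 2"] by simp
      then have "real (2 * n) = real k"
        using assms(2) by (simp add: x_def field_simps)
      then have "2 * n = k"
        by (simp only: of_nat_eq_iff)
      with assms(1) show False
        by auto
    qed
    from sin_squared_div_sin_double_power4[OF s this] show ?thesis
      by (simp add: x_def mult.assoc)
  qed
  then have "(\<Sum>n=1..k-1. sin (pi * real n / real k) ^ 2 / sin (2 * pi * real n / real k) ^ 4)
      = ((\<Sum>n=1..k-1. 1 / sin (pi * real n / real k) ^ 2)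
        + (\<Sum>n=1..k-1. 1 / cos (pi * real n / real k) ^ 2)
        + (\<Sum>n=1..k-1. 1 / cos (pi * real n / real k) ^ 4)) / 16"
    unfolding sum.distrib[symmetric] sum_divide_distrib by (intro sum.cong refl)
  \<comment> \<open>The full sums over n < k contain the n = 0 term 1/cos 0 = 1, which accounts for
    the -1 here and in the fourth-power sum.\<close>
  also have "(\<Sum>n=1..k-1. 1 / cos (pi * real n / real k) ^ 2) = (real k)\<^sup>2 - 1"
    by (simp only: sum_atLeast1_eq_sum_lessThan[OF assms(2)] sum_inverse_cos_power2[OF assms(1)]) simp
  also have "(\<Sum>n=1..k-1. 1 / cos (pi * real n / real k) ^ 4)
      = (real k ^ 4 + 2 * (real k)\<^sup>2) / 3 - 1"
    by (simp only: sum_atLeast1_eq_sum_lessThan[OF assms(2)] sum_inverse_cos_power4[OF assms(1)]) simp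
  finally show ?thesis
    using sum_inverse_sin_power2[OF assms(2)] by (simp add: field_simps)
qed

end
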